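(* Let $X=\tau(t,x,u)\,\partial_t+\xi(t,x,u)\,\partial_x+\eta(t,x,u)\,\partial_u$ be a Lie point symmetry generator of the equation $$u_{t}-u_{txx}=4uu_{x}+2u_{x}^{2}+2uu_{xx}-6u_{x}u_{xx}-2uu_{xxx}.$$ Then $X$ is a linear combination (with real constant coefficients) of the operators $$X_1=\partial_x,\qquad X_2=\partial_t,\qquad X_3=t\,\partial_t-u\,\partial_u .$$
   Context: Here $u=u(t,x)$ is a real-valued function of two independent real variables and subscripts denote partial derivatives. A vector field $X=\tau(t,x,u)\partial_t+\xi(t,x,u)\partial_x+\eta(t,x,u)\partial_u$ with smooth coefficients on the space of variables $(t,x,u)\in\mathbb{R}^3$ is a Lie point symmetry generator of the third-order equation $\Delta=0$, where $\Delta=u_{t}-u_{txx}-(4uu_{x}+2u_{x}^{2}+2uu_{xx}-6u_{x}u_{xx}-2uu_{xxx})$, if its (local) flow maps solutions to solutions; equivalently, the invariance condition $X^{(3)}\Delta=0$ holds whenever $\Delta=0$, where $X^{(3)}$ is the standard third-order prolongation of $X$ to the jet space of derivatives of $u$ up to order three. *)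

theory Defs
  imports "HOL-Analysis.Analysis"
begin

primrec C_times :: "nat \<Rightarrow> ('a::real_normed_vector \<Rightarrow> 'b::real_normed_vector) \<Rightarrow> bool" where
  "C_times 0 f \<longleftrightarrow> continuous_on UNIV f"
| "C_times (Suc k) f \<longleftrightarrow>
     (\<forall>p. f differentiable (at p)) \<and> (\<forall>v. C_times k (\<lambda>p. frechet_derivative f (at p) v))"

definition smooth :: "('a::real_normed_vector \<Rightarrow> 'b::real_normed_vector) \<Rightarrow> bool" where
  "smooth f \<longleftrightarrow> (\<forall>k. C_times k f)"

text \<open>
  Coordinates on the jet spaces of functions u(t, x): the independent variables t, x together
  with U, where U (i, j) stands for the derivative of u taken i times in t and j times in x
  (so U (0, 0) is u itself). A differential function of order n is a function of
  t, x and those U (i, j) with i + j at most n.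
\<close>

type_synonym diff_fun = "real \<Rightarrow> real \<Rightarrow> (nat \<times> nat \<Rightarrow> real) \<Rightarrow> real"

definition jet_partial :: "nat \<times> nat \<Rightarrow> diff_fun \<Rightarrow> diff_fun" where
  "jet_partial k F t x U = deriv (\<lambda>s. F t x (U(k := s))) (U k)"

definition jet_indices :: "nat \<Rightarrow> (nat \<times> nat) set" where
  "jet_indices n = {(i, j). i + j \<le> n}"

text \<open>Total derivatives of a differential function of order n; the result has order n + 1.\<close>

definition total_Dt :: "nat \<Rightarrow> diff_fun \<Rightarrow> diff_fun" where
  "total_Dt n F t x U =
     deriv (\<lambda>s. F s x U) t + (\<Sum>(i, j)\<in>jet_indices n. U (Suc i, j) * jet_partial (i, j) F t x U)"

definition total_Dx :: "nat \<Rightarrow> diff_fun \<Rightarrow> diff_fun" where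
  "total_Dx n F t x U =
     deriv (\<lambda>s. F t s U) x + (\<Sum>(i, j)\<in>jet_indices n. U (i, Suc j) * jet_partial (i, j) F t x U)"

text \<open>
  A vector field on the space of variables (t, x, u) is given by its three components along
  the coordinate fields of t, x and u, in this order.
\<close>

type_synonym vfield = "real \<times> real \<times> real \<Rightarrow> real \<times> real \<times> real"

definition coeff_t :: "vfield \<Rightarrow> diff_fun" where
  "coeff_t X t x U = fst (X (t, x, U (0, 0)))"

definition coeff_x :: "vfield \<Rightarrow> diff_fun" where
  "coeff_x X t x U = fst (snd (X (t, x, U (0, 0))))"

definition coeff_u :: "vfield \<Rightarrow> diff_fun" where
  "coeff_u X t x U = snd (snd (X (t, x, U (0, 0))))"

text \<open>
  The coefficient of the prolonged vector field along the coordinate U (i, j), by the usual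
  recursion: the coefficient belonging to one further derivative in t is D_t of the previous
  coefficient, minus U (i + 1, j) times D_t of the t-component, minus U (i, j + 1) times D_t of
  the x-component; similarly for x. For a smooth vector field the result does not depend on the
  order in which derivatives are added, and here all the t-derivatives are added first.
\<close>

fun prolong_coeff :: "vfield \<Rightarrow> nat \<Rightarrow> nat \<Rightarrow> diff_fun" where
  "prolong_coeff X 0 0 = coeff_u X"
| "prolong_coeff X (Suc i) 0 = (\<lambda>t x U.
     total_Dt i (prolong_coeff X i 0) t x U
     - U (Suc i, 0) * total_Dt 0 (coeff_t X) t x U
     - U (i, 1) * total_Dt 0 (coeff_x X) t x U)"
| "prolong_coeff X i (Suc j) = (\<lambda>t x U.
     total_Dx (i + j) (prolong_coeff X i j) t x U
     - U (Suc i, j) * total_Dx 0 (coeff_t X) t x U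
     - U (i, Suc j) * total_Dx 0 (coeff_x X) t x U)"

text \<open>The n-th prolongation of X, acting as a derivation on differential functions of order n.\<close>

definition prolongation :: "nat \<Rightarrow> vfield \<Rightarrow> diff_fun \<Rightarrow> diff_fun" where
  "prolongation n X F t x U =
     coeff_t X t x U * deriv (\<lambda>s. F s x U) t
     + coeff_x X t x U * deriv (\<lambda>s. F t s U) x
     + (\<Sum>(i, j)\<in>jet_indices n. prolong_coeff X i j t x U * jet_partial (i, j) F t x U)"

text \<open>Infinitesimal invariance of the equation F = 0 of order n.\<close>

definition lie_point_symmetry_generator :: "nat \<Rightarrow> diff_fun \<Rightarrow> vfield \<Rightarrow> bool" where
  "lie_point_symmetry_generator n F X \<longleftrightarrow>
     smooth X \<and> (\<forall>t x U. F t x U = 0 \<longrightarrow> prolongation n X F t x U = 0)"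

definition Delta :: diff_fun where
  "Delta t x U =
     (let u = U (0, 0); u_t = U (1, 0); u_x = U (0, 1); u_xx = U (0, 2);
          u_xxx = U (0, 3); u_txx = U (1, 2)
      in u_t - u_txx
         - (4 * u * u_x + 2 * u_x\<^sup>2 + 2 * u * u_xx - 6 * u_x * u_xx - 2 * u * u_xxx))"

definition X1 :: vfield where "X1 = (\<lambda>(t, x, u). (0, 1, 0))"
definition X2 :: vfield where "X2 = (\<lambda>(t, x, u). (1, 0, 0))"
definition X3 :: vfield where "X3 = (\<lambda>(t, x, u). (t, 0, - u))"

end

theory Submission
  imports Defs
begin

text \<open>
  Write X as \<open>\<tau> \<partial>t + \<xi> \<partial>x + \<eta> \<partial>u\<close>. The invariance condition is required at every jet that satisfies
  the equation, and the equation can be solved for \<open>u_txx\<close>; so all other jet coordinates may be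
  chosen freely, and the coefficient of each monomial in them has to vanish. The proof compares
  a few well chosen jets and reads off these determining equations one after the other.

  The third-order coordinates come first. A prolongation coefficient of order two or three
  is affine in the coordinates of its highest order, with coefficients that involve only first derivatives of
  \<open>\<tau>\<close>, \<open>\<xi>\<close>, \<open>\<eta>\<close> (\<open>prolong_coeff_diff\<close>, \<open>jet_partial_prolong_coeff_top\<close>). Hence the determining
  equations belonging to \<open>u_ttx\<close> and \<open>u_xxx\<close> can be found while the rest of the prolongation,
  which has a very large number of terms for a general X, stays unevaluated.
  The coefficient of \<open>u_ttx\<close> forces \<open>\<tau>\<close> to depend on t alone (\<open>tau_x_u\<close>). The coefficient of
  \<open>u_xxx\<close>, where \<open>u_txx\<close> moves along by \<open>2 u\<close>, forces \<open>\<xi>\<close> to be independent of u and expresses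
  \<open>\<eta>\<close> through \<open>\<xi>\<close> and \<open>\<tau>\<close> (\<open>xi_u\<close>, \<open>eta_eq\<close>): \<open>\<eta> = u (\<xi>_x - \<tau>_t) - \<xi>_t / 2\<close>.

  With such coefficients every prolongation coefficient is affine in all the jet coordinates,
  and short enough to be written down (\<open>prolong_01\<close> to \<open>prolong_12\<close>). Switching on one of the
  coordinates \<open>u_tx\<close>, \<open>u_t\<close>, \<open>u_x\<close>, \<open>u_xx\<close> at a time gives, in this order, \<open>\<xi>_xx = 0\<close>, \<open>\<xi>_x = 0\<close>,
  \<open>\<xi>_t = 0\<close> and \<open>\<tau>_tt = 0\<close>. So \<open>\<xi> = c1\<close>, \<open>\<tau> = c2 + c3 t\<close> and \<open>\<eta> = - c3 u\<close>.
\<close>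

section \<open>Smooth functions and their partial derivatives\<close>

definition dir_deriv :: "'a \<Rightarrow> ('a::real_normed_vector \<Rightarrow> 'b::real_normed_vector) \<Rightarrow> 'a \<Rightarrow> 'b" where
  "dir_deriv v f p = frechet_derivative f (at p) v"

lemma smooth_imp_differentiable: "smooth f \<Longrightarrow> f differentiable (at p)"
  unfolding smooth_def by (metis C_times.simps(2))

lemma smooth_dir_deriv: "smooth f \<Longrightarrow> smooth (dir_deriv v f)"
  unfolding smooth_def dir_deriv_def using C_times.simps(2) by blast

text \<open>
  A bounded linear map commutes with differentiation. This makes the three components of a
  smooth vector field smooth.
\<close>

lemma C_times_bounded_linear:
  assumes L: "bounded_linear L"
  shows "C_times k f \<Longrightarrow> C_times k (\<lambda>p. L (f p))"
proof (induction k arbitrary: f)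
  case 0
  then show ?case using L by (simp add: linear_continuous_on_compose bounded_linear.continuous_on)
next
  case (Suc k)
  have d: "((\<lambda>p. L (f p)) has_derivative (\<lambda>v. L (frechet_derivative f (at p) v))) (at p)" for p
    using Suc.prems by (intro bounded_linear.has_derivative[OF L]) (simp add: frechet_derivative_works[symmetric])
  then have "frechet_derivative (\<lambda>p. L (f p)) (at p) = (\<lambda>v. L (frechet_derivative f (at p) v))" for p
    by (metis frechet_derivative_at)
  with Suc d show ?case by (auto simp: differentiable_def)
qed

lemma smooth_bounded_linear: "bounded_linear L \<Longrightarrow> smooth f \<Longrightarrow> smooth (\<lambda>p. L (f p))"
  unfolding smooth_def using C_times_bounded_linear by blast

abbreviation pd_t :: "(real \<times> real \<times> real \<Rightarrow> real) \<Rightarrow> real \<times> real \<times> real \<Rightarrow> real" where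
  "pd_t \<equiv> dir_deriv (1, 0, 0)"
abbreviation pd_x :: "(real \<times> real \<times> real \<Rightarrow> real) \<Rightarrow> real \<times> real \<times> real \<Rightarrow> real" where
  "pd_x \<equiv> dir_deriv (0, 1, 0)"
abbreviation pd_u :: "(real \<times> real \<times> real \<Rightarrow> real) \<Rightarrow> real \<times> real \<times> real \<Rightarrow> real" where
  "pd_u \<equiv> dir_deriv (0, 0, 1)"

lemma has_real_derivative_along_curve:
  fixes f :: "'a::real_normed_vector \<Rightarrow> real"
  assumes "smooth f" and g: "(g has_derivative (\<lambda>h. h *\<^sub>R v)) (at (s::real))"
  shows "((\<lambda>s. f (g s)) has_real_derivative dir_deriv v f (g s)) (at s)"
proof -
  have f: "(f has_derivative frechet_derivative f (at (g s))) (at (g s))"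
    using assms(1) smooth_imp_differentiable frechet_derivative_works by blast
  then have "frechet_derivative f (at (g s)) (h *\<^sub>R v) = dir_deriv v f (g s) * h" for h
    by (simp add: dir_deriv_def linear_cmul has_derivative_linear)
  with has_derivative_compose[OF g f] show ?thesis
    by (simp add: has_field_derivative_def)
qed

lemma
  assumes "smooth f"
  shows has_pd_t: "((\<lambda>s. f (s, x, u)) has_real_derivative pd_t f (t, x, u)) (at t)"
    and has_pd_x: "((\<lambda>s. f (t, s, u)) has_real_derivative pd_x f (t, x, u)) (at x)"
    and has_pd_u: "((\<lambda>s. f (t, x, s)) has_real_derivative pd_u f (t, x, u)) (at u)"
proof -
  show "((\<lambda>s. f (s, x, u)) has_real_derivative pd_t f (t, x, u)) (at t)"
    by (rule has_real_derivative_along_curve[OF assms, where g = "\<lambda>s. (s, x, u)"])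
      (rule has_derivative_eq_rhs, (rule has_derivative_Pair has_derivative_ident has_derivative_const)+,
        simp add: zero_prod_def)
  show "((\<lambda>s. f (t, s, u)) has_real_derivative pd_x f (t, x, u)) (at x)"
    by (rule has_real_derivative_along_curve[OF assms, where g = "\<lambda>s. (t, s, u)"])
      (rule has_derivative_eq_rhs, (rule has_derivative_Pair has_derivative_ident has_derivative_const)+,
        simp add: zero_prod_def)
  show "((\<lambda>s. f (t, x, s)) has_real_derivative pd_u f (t, x, u)) (at u)"
    by (rule has_real_derivative_along_curve[OF assms, where g = "\<lambda>s. (t, x, s)"])
      (rule has_derivative_eq_rhs, (rule has_derivative_Pair has_derivative_ident has_derivative_const)+,
        simp add: zero_prod_def)
qed

lemmas deriv_slices =
  has_pd_t[THEN DERIV_imp_deriv] has_pd_x[THEN DERIV_imp_deriv] has_pd_u[THEN DERIV_imp_deriv]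

text \<open>
  If the derivative along \<open>v\<close> vanishes identically, then \<open>f\<close> is invariant under translations
  along \<open>v\<close>; all its derivatives inherit this invariance. In this way independence of a
  variable passes from the coefficients of a vector field to their derivatives.
\<close>

lemma dir_deriv_swap_eq_0:
  fixes f :: "'a::real_normed_vector \<Rightarrow> real"
  assumes f: "smooth f" and zero: "\<And>p. dir_deriv v f p = 0"
  shows "dir_deriv v (dir_deriv w f) p = 0"
proof -
  have line: "((\<lambda>r. p + r *\<^sub>R v) has_derivative (\<lambda>h. h *\<^sub>R v)) (at s)" for p and s :: real
    by (auto intro!: derivative_eq_intros)
  have const: "f (q + s *\<^sub>R v) = f q" for q s
  proof -
    have "((\<lambda>r. f (q + r *\<^sub>R v)) has_real_derivative 0) (at r)" for r
      using has_real_derivative_along_curve[OF f line, of q r] zero by simp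
    then show ?thesis using DERIV_isconst_all[of "\<lambda>r. f (q + r *\<^sub>R v)" s 0] by simp
  qed
  have "dir_deriv w f (p + s *\<^sub>R v) = dir_deriv w f p" for s
  proof -
    have "((\<lambda>q. f (q + s *\<^sub>R v)) has_derivative frechet_derivative f (at (p + s *\<^sub>R v))) (at p)"
    proof (rule has_derivative_compose[where f' = "\<lambda>h. h", of "\<lambda>q. q + s *\<^sub>R v" p UNIV f])
      show "((\<lambda>q. q + s *\<^sub>R v) has_derivative (\<lambda>h. h)) (at p)"
        by (auto intro!: derivative_eq_intros)
      show "(f has_derivative frechet_derivative f (at (p + s *\<^sub>R v))) (at (p + s *\<^sub>R v))"
        using smooth_imp_differentiable[OF f] by (simp add: frechet_derivative_works[symmetric])
    qed
    then show ?thesis by (simp add: const dir_deriv_def frechet_derivative_at[symmetric])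
  qed
  then have "((\<lambda>s. dir_deriv w f (p + s *\<^sub>R v)) has_real_derivative 0) (at 0)" by simp
  with has_real_derivative_along_curve[OF smooth_dir_deriv[OF f] line, of w p 0] show ?thesis
    using DERIV_unique by fastforce
qed

lemma dir_deriv_zero: "dir_deriv v (\<lambda>_. 0) = (\<lambda>_. 0)"
  by (simp add: dir_deriv_def fun_eq_iff)

lemma constant_if_partials_0:
  assumes f: "smooth f" and zero: "\<And>p. pd_t f p = 0" "\<And>p. pd_x f p = 0" "\<And>p. pd_u f p = 0"
  shows "f p = f (0, 0, 0)"
proof -
  obtain t x u where p: "p = (t, x, u)" by (cases p)
  have "f (t, x, u) = f (0, x, u)"
    using DERIV_isconst_all[of "\<lambda>s. f (s, x, u)" t 0] has_pd_t[OF f] zero by simp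
  also have "\<dots> = f (0, 0, u)"
    using DERIV_isconst_all[of "\<lambda>s. f (0, s, u)" x 0] has_pd_x[OF f] zero by simp
  also have "\<dots> = f (0, 0, 0)"
    using DERIV_isconst_all[of "\<lambda>s. f (0, 0, s)" u 0] has_pd_u[OF f] zero by simp
  finally show ?thesis unfolding p .
qed

section \<open>Dependence on the jet coordinates of highest order\<close>

text \<open>
  The type of differential functions does not bound their order, so the order is a semantic
  condition: the value is determined by the coordinates of order at most \<open>n\<close>.
\<close>

definition jet_order_le :: "nat \<Rightarrow> diff_fun \<Rightarrow> bool" where
  "jet_order_le n F \<longleftrightarrow> (\<forall>t x U V. (\<forall>k\<in>jet_indices n. U k = V k) \<longrightarrow> F t x U = F t x V)"

lemma jet_order_leD:
  "jet_order_le n F \<Longrightarrow> (\<And>k. k \<in> jet_indices n \<Longrightarrow> U k = V k) \<Longrightarrow> F t x U = F t x V"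
  unfolding jet_order_le_def by blast

lemma finite_jet_indices [simp]: "finite (jet_indices n)"
  by (rule finite_subset[of _ "{..n} \<times> {..n}"]) (auto simp: jet_indices_def)

lemma jet_indices_Suc: "jet_indices (Suc n) = jet_indices n \<union> (\<lambda>j. (Suc n - j, j)) ` {..Suc n}"
  by (force simp: jet_indices_def le_Suc_eq)

lemma jet_indices_explicit:
  "jet_indices 0 = {(0, 0)}"
  "jet_indices (Suc 0) = {(0, 0), (1, 0), (0, 1)}"
  "jet_indices (Suc (Suc 0)) = {(0, 0), (1, 0), (0, 1), (2, 0), (1, 1), (0, 2)}"
  "jet_indices 3 = {(0, 0), (1, 0), (0, 1), (2, 0), (1, 1), (0, 2), (3, 0), (2, 1), (1, 2), (0, 3)}"
proof -
  show 0: "jet_indices 0 = {(0, 0)}"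
    by (auto simp: jet_indices_def)
  show 1: "jet_indices (Suc 0) = {(0, 0), (1, 0), (0, 1)}"
    unfolding jet_indices_Suc 0 by (simp add: atMost_Suc insert_commute)
  show 2: "jet_indices (Suc (Suc 0)) = {(0, 0), (1, 0), (0, 1), (2, 0), (1, 1), (0, 2)}"
    unfolding jet_indices_Suc[of "Suc 0"] 1 by (simp add: atMost_Suc insert_commute numeral_2_eq_2)
  show "jet_indices 3 = {(0, 0), (1, 0), (0, 1), (2, 0), (1, 1), (0, 2), (3, 0), (2, 1), (1, 2), (0, 3)}"
    unfolding numeral_3_eq_3 jet_indices_Suc[of "Suc (Suc 0)"] 2
    by (simp add: atMost_Suc insert_commute numeral_2_eq_2)
qed

text \<open>
  This holds without any differentiability: along a coordinate of order at most \<open>n\<close> the two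
  functions of one variable under the derivative are equal, along any other coordinate both are
  constant.
\<close>

lemma jet_order_le_jet_partial:
  assumes F: "jet_order_le n F"
  shows "jet_order_le n (jet_partial k F)"
  unfolding jet_order_le_def
proof (intro allI impI)
  fix t x U V assume UV: "\<forall>k\<in>jet_indices n. U k = (V k :: real)"
  show "jet_partial k F t x U = jet_partial k F t x V"
  proof (cases "k \<in> jet_indices n")
    case True
    have "F t x (U(k := s)) = F t x (V(k := s))" for s
      by (rule jet_order_leD[OF F]) (use UV in auto)
    with True UV show ?thesis by (simp add: jet_partial_def)
  next
    case False
    have "F t x (W(k := s)) = F t x W" for W s
      by (rule jet_order_leD[OF F]) (use False in auto)
    then show ?thesis by (simp add: jet_partial_def)
  qed
qed

lemma jet_order_le_mono: "jet_order_le m F \<Longrightarrow> m \<le> n \<Longrightarrow> jet_order_le n F"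
  unfolding jet_order_le_def jet_indices_def by fastforce

lemma jet_order_le_total_Dx:
  assumes F: "jet_order_le n F"
  shows "jet_order_le (Suc n) (total_Dx n F)"
  unfolding jet_order_le_def
proof (intro allI impI)
  fix t x U V assume UV: "\<forall>k\<in>jet_indices (Suc n). U k = (V k :: real)"
  then have UV': "U k = V k" if "k \<in> jet_indices n" for k using that by (auto simp: jet_indices_def)
  have "F t s U = F t s V" for s
    using F UV' by (rule jet_order_leD)
  moreover have "jet_partial k F t x U = jet_partial k F t x V" for k
    using jet_order_le_jet_partial[OF F] UV' by (rule jet_order_leD)
  moreover have "U (i, Suc j) = V (i, Suc j)" if "(i, j) \<in> jet_indices n" for i j
    using that UV by (auto simp: jet_indices_def)
  ultimately show "total_Dx n F t x U = total_Dx n F t x V"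
    unfolding total_Dx_def by (auto intro!: sum.cong)
qed

lemma jet_order_le_total_Dt:
  assumes F: "jet_order_le n F"
  shows "jet_order_le (Suc n) (total_Dt n F)"
  unfolding jet_order_le_def
proof (intro allI impI)
  fix t x U V assume UV: "\<forall>k\<in>jet_indices (Suc n). U k = (V k :: real)"
  then have UV': "U k = V k" if "k \<in> jet_indices n" for k using that by (auto simp: jet_indices_def)
  have "F s x U = F s x V" for s
    using F UV' by (rule jet_order_leD)
  moreover have "jet_partial k F t x U = jet_partial k F t x V" for k
    using jet_order_le_jet_partial[OF F] UV' by (rule jet_order_leD)
  moreover have "U (Suc i, j) = V (Suc i, j)" if "(i, j) \<in> jet_indices n" for i j
    using that UV by (auto simp: jet_indices_def)
  ultimately show "total_Dt n F t x U = total_Dt n F t x V"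
    unfolding total_Dt_def by (auto intro!: sum.cong)
qed

lemma jet_order_le_coeff:
  "jet_order_le 0 (coeff_t X)" "jet_order_le 0 (coeff_x X)" "jet_order_le 0 (coeff_u X)"
  by (auto simp: jet_order_le_def jet_indices_def coeff_t_def coeff_x_def coeff_u_def)

lemma jet_order_le_total_coeff:
  assumes "1 \<le> n"
  shows "jet_order_le n (total_Dx 0 (coeff_t X))" "jet_order_le n (total_Dx 0 (coeff_x X))"
    "jet_order_le n (total_Dt 0 (coeff_t X))" "jet_order_le n (total_Dt 0 (coeff_x X))"
  by (rule jet_order_le_mono[OF jet_order_le_total_Dx[OF jet_order_le_coeff(1)]]
      jet_order_le_mono[OF jet_order_le_total_Dx[OF jet_order_le_coeff(2)]]
      jet_order_le_mono[OF jet_order_le_total_Dt[OF jet_order_le_coeff(1)]]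
      jet_order_le_mono[OF jet_order_le_total_Dt[OF jet_order_le_coeff(2)]]; use assms in simp)+

text \<open>
  The shape of the recursion for the prolongation coefficients.
\<close>

lemma jet_order_le_combine:
  assumes "jet_order_le n F" "jet_order_le n G" "jet_order_le n H"
    and "k \<in> jet_indices n" "l \<in> jet_indices n"
  shows "jet_order_le n (\<lambda>t x U. F t x U - U k * G t x U - U l * H t x U)"
  unfolding jet_order_le_def
proof (intro allI impI)
  fix t x U V assume UV: "\<forall>k\<in>jet_indices n. U k = (V k :: real)"
  then have "F t x U = F t x V" "G t x U = G t x V" "H t x U = H t x V" "U k = V k" "U l = V l"
    using assms by (auto intro: jet_order_leD)
  then show "F t x U - U k * G t x U - U l * H t x U = F t x V - V k * G t x V - V l * H t x V"
    by simp
qed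

lemma jet_order_le_prolong_coeff: "jet_order_le (i + j) (prolong_coeff X i j)"
proof (induction X i j rule: prolong_coeff.induct)
  case (1 X)
  then show ?case by (simp add: jet_order_le_coeff)
next
  case (2 X i)
  have "jet_order_le (Suc i) (total_Dt i (prolong_coeff X i 0))"
    using jet_order_le_total_Dt[OF 2] by simp
  from jet_order_le_combine[OF this jet_order_le_total_coeff(3,4)] show ?case
    by (simp add: jet_indices_def)
next
  case (3 X i j)
  from jet_order_le_combine[OF jet_order_le_total_Dx[OF 3] jet_order_le_total_coeff(1,2)] show ?case
    by (simp add: jet_indices_def)
qed

text \<open>
  The coordinates of order \<open>n + 1\<close> enter a total derivative only as the explicit factors in its
  sum. The summands with \<open>i + j < n\<close> vanish here because the jets agree up to order \<open>n\<close>.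
\<close>

lemma total_Dx_diff:
  assumes F: "jet_order_le n F" and UV: "\<forall>k\<in>jet_indices n. U k = V k"
  shows "total_Dx n F t x U - total_Dx n F t x V =
    (\<Sum>(i, j)\<in>jet_indices n. (U (i, Suc j) - V (i, Suc j)) * jet_partial (i, j) F t x U)"
proof -
  have "F t s U = F t s V" for s
    using F bspec[OF UV] by (rule jet_order_leD)
  moreover have "jet_partial k F t x U = jet_partial k F t x V" for k
    using jet_order_le_jet_partial[OF F] bspec[OF UV] by (rule jet_order_leD)
  ultimately show ?thesis
    unfolding total_Dx_def
    by (simp add: sum_subtractf[symmetric] case_prod_unfold left_diff_distrib)
qed

text \<open>
  The two subtracted terms of the recursion carry the total derivatives of the t- and
  x-components, which have order one; the assumption \<open>1 \<le> i + j\<close> makes these the same at both jets.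
\<close>

lemma prolong_coeff_diff:
  assumes UV: "\<forall>k\<in>jet_indices (i + j). U k = V k" and pos: "1 \<le> i + j"
  shows "prolong_coeff X i (Suc j) t x U - prolong_coeff X i (Suc j) t x V =
    (\<Sum>(a, b)\<in>jet_indices (i + j).
        (U (a, Suc b) - V (a, Suc b)) * jet_partial (a, b) (prolong_coeff X i j) t x U)
    - (U (Suc i, j) - V (Suc i, j)) * total_Dx 0 (coeff_t X) t x U
    - (U (i, Suc j) - V (i, Suc j)) * total_Dx 0 (coeff_x X) t x U"
proof -
  have "total_Dx 0 (coeff_t X) t x U = total_Dx 0 (coeff_t X) t x V"
    using jet_order_le_total_coeff(1)[OF pos] bspec[OF UV] by (rule jet_order_leD)
  moreover have "total_Dx 0 (coeff_x X) t x U = total_Dx 0 (coeff_x X) t x V"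
    using jet_order_le_total_coeff(2)[OF pos] bspec[OF UV] by (rule jet_order_leD)
  moreover note total_Dx_diff[of "i + j" "prolong_coeff X i j" U V t x, OF jet_order_le_prolong_coeff UV]
  ultimately show ?thesis
    by (simp add: algebra_simps)
qed

lemma jet_partial_affine:
  assumes "\<And>V. (\<And>l. l \<noteq> k \<Longrightarrow> U l = V l) \<Longrightarrow> F t x U - F t x V = (U k - V k) * c"
  shows "jet_partial k F t x U = c"
proof -
  have "F t x (U(k := s)) = F t x U + (s - U k) * c" for s
    using assms[of "U(k := s)"] by (simp add: algebra_simps)
  then show ?thesis
    unfolding jet_partial_def by (intro DERIV_imp_deriv) (auto intro!: derivative_eq_intros)
qed

declare prolong_coeff.simps [simp del]

text \<open>
  By \<open>prolong_coeff_diff\<close>, changing a single coordinate of highest order changes the coefficient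
  linearly, and the slope is a top partial derivative of the previous coefficient, corrected
  where the coordinate is one of the two explicit factors of the recursion. Iterating this
  reduces every top partial derivative to those of the first-order coefficients.
\<close>

lemma jet_partial_prolong_coeff_top:
  assumes pos: "1 \<le> i + j" and ab: "a + b = Suc (i + j)"
  shows "jet_partial (a, b) (prolong_coeff X i (Suc j)) t x U =
    (if b = 0 then 0 else jet_partial (a, b - 1) (prolong_coeff X i j) t x U)
    - (if (a, b) = (Suc i, j) then total_Dx 0 (coeff_t X) t x U else 0)
    - (if (a, b) = (i, Suc j) then total_Dx 0 (coeff_x X) t x U else 0)"
proof (rule jet_partial_affine)
  fix V assume UV: "\<And>l. l \<noteq> (a, b) \<Longrightarrow> U l = V l"
  let ?P = "\<lambda>k. jet_partial k (prolong_coeff X i j) t x U"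
  have "(\<Sum>(c, d)\<in>jet_indices (i + j). (U (c, Suc d) - V (c, Suc d)) * ?P (c, d)) =
    (\<Sum>k\<in>jet_indices (i + j). if k = (a, b - 1) \<and> b \<noteq> 0 then (U (a, b) - V (a, b)) * ?P k else 0)"
  proof (rule sum.cong, rule refl, clarify)
    fix c d
    show "(U (c, Suc d) - V (c, Suc d)) * ?P (c, d) =
      (if (c, d) = (a, b - 1) \<and> b \<noteq> 0 then (U (a, b) - V (a, b)) * ?P (c, d) else 0)"
    proof (cases "(c, Suc d) = (a, b)")
      case False
      then show ?thesis using UV[OF False] by (cases b) auto
    qed auto
  qed
  also have "\<dots> = (U (a, b) - V (a, b)) * (if b = 0 then 0 else ?P (a, b - 1))"
  proof (cases b)
    case (Suc d)
    then have "(a, d) \<in> jet_indices (i + j)" using ab by (simp add: jet_indices_def)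
    with Suc show ?thesis by (simp only: sum.delta finite_jet_indices) simp
  qed simp
  finally have S: "(\<Sum>(c, d)\<in>jet_indices (i + j). (U (c, Suc d) - V (c, Suc d)) * ?P (c, d)) = \<dots>" .
  have "\<forall>k\<in>jet_indices (i + j). U k = V k"
    by (intro ballI UV) (use ab in \<open>auto simp: jet_indices_def\<close>)
  note diff = prolong_coeff_diff[of i j U V X t x, OF this pos]
  have "U (Suc i, j) - V (Suc i, j) = (if (a, b) = (Suc i, j) then U (a, b) - V (a, b) else 0)"
    using UV[of "(Suc i, j)"] by (cases "(a, b) = (Suc i, j)") auto
  moreover have "U (i, Suc j) - V (i, Suc j) = (if (a, b) = (i, Suc j) then U (a, b) - V (a, b) else 0)"
    using UV[of "(i, Suc j)"] by (cases "(a, b) = (i, Suc j)") auto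
  ultimately show "prolong_coeff X i (Suc j) t x U - prolong_coeff X i (Suc j) t x V =
      (U (a, b) - V (a, b)) * ((if b = 0 then 0 else ?P (a, b - 1))
      - (if (a, b) = (Suc i, j) then total_Dx 0 (coeff_t X) t x U else 0)
      - (if (a, b) = (i, Suc j) then total_Dx 0 (coeff_x X) t x U else 0))"
    by (simp only: diff S right_diff_distrib if_distrib[of "(*) _"] mult_zero_right
        if_distrib[of "\<lambda>y. y * _"] mult_zero_left)
qed

lemma agree_on_jet_indices_2:
  assumes "\<forall>k\<in>jet_indices 2. U k = (V k::real)"
  shows "U (0, 0) = V (0, 0)" "U (Suc 0, 0) = V (Suc 0, 0)" "U (0, Suc 0) = V (0, Suc 0)"
    "U (Suc (Suc 0), 0) = V (Suc (Suc 0), 0)" "U (Suc 0, Suc 0) = V (Suc 0, Suc 0)"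
    "U (0, Suc (Suc 0)) = V (0, Suc (Suc 0))"
  using assms by (auto simp: jet_indices_def)

text \<open>
  In the next two lemmas each of the two further x-derivatives contributes one copy of the
  total derivative of a component, and the multiple 2 counts them.
\<close>

lemma prolong_12_diff:
  assumes UV: "\<forall>k\<in>jet_indices 2. U k = V k"
  shows "prolong_coeff X 1 2 t x U - prolong_coeff X 1 2 t x V =
    (U (2, 1) - V (2, 1)) * (- 2 * total_Dx 0 (coeff_t X) t x U)
    + (U (1, 2) - V (1, 2)) * (jet_partial (1, 0) (prolong_coeff X 1 0) t x U
         - 2 * total_Dx 0 (coeff_x X) t x U)
    + (U (0, 3) - V (0, 3)) * jet_partial (0, 1) (prolong_coeff X 1 0) t x U"
  using prolong_coeff_diff[of "Suc 0" "Suc 0" U V X t x] UV agree_on_jet_indices_2[OF UV]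
    by (simp add: jet_indices_explicit jet_partial_prolong_coeff_top algebra_simps numeral_2_eq_2 numeral_3_eq_3)

lemma prolong_03_diff:
  assumes UV: "\<forall>k\<in>jet_indices 2. U k = V k"
  shows "prolong_coeff X 0 3 t x U - prolong_coeff X 0 3 t x V =
    (U (1, 2) - V (1, 2)) * (jet_partial (1, 0) (prolong_coeff X 0 1) t x U
         - 2 * total_Dx 0 (coeff_t X) t x U)
    + (U (0, 3) - V (0, 3)) * (jet_partial (0, 1) (prolong_coeff X 0 1) t x U
         - 2 * total_Dx 0 (coeff_x X) t x U)"
  using prolong_coeff_diff[of 0 "Suc (Suc 0)" U V X t x] UV agree_on_jet_indices_2[OF UV]
    by (simp add: jet_indices_explicit jet_partial_prolong_coeff_top algebra_simps numeral_2_eq_2 numeral_3_eq_3)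

section \<open>The total derivative as a derivation\<close>

lemma total_point_function:
  assumes "smooth f"
  shows "total_Dt 0 (\<lambda>t x U. f (t, x, U (0, 0))) t x U =
      pd_t f (t, x, U (0, 0)) + U (1, 0) * pd_u f (t, x, U (0, 0))"
    and "total_Dx 0 (\<lambda>t x U. f (t, x, U (0, 0))) t x U =
      pd_x f (t, x, U (0, 0)) + U (0, 1) * pd_u f (t, x, U (0, 0))"
  using assms by (simp_all add: total_Dt_def total_Dx_def jet_indices_explicit jet_partial_def deriv_slices)

text \<open>
  The total derivative in the style of \<open>has_real_derivative\<close>: the existence of the partial
  derivatives is part of the notion, and a sum and a product rule follow. An explicit
  expression is then differentiated by applying the rules along its structure.
\<close>

definition has_total_Dx :: "nat \<Rightarrow> diff_fun \<Rightarrow> real \<Rightarrow> real \<Rightarrow> real \<Rightarrow> (nat \<times> nat \<Rightarrow> real) \<Rightarrow> bool" where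
  "has_total_Dx n F D t x U \<longleftrightarrow> (\<exists>a b.
     ((\<lambda>s. F t s U) has_real_derivative a) (at x) \<and>
     (\<forall>k\<in>jet_indices n. ((\<lambda>s. F t x (U(k := s))) has_real_derivative b k) (at (U k))) \<and>
     D = a + (\<Sum>(i, j)\<in>jet_indices n. U (i, Suc j) * b (i, j)))"

lemma has_total_Dx_imp_eq:
  assumes "has_total_Dx n F D t x U"
  shows "total_Dx n F t x U = D"
proof -
  from assms obtain a b where a: "((\<lambda>s. F t s U) has_real_derivative a) (at x)"
    and b: "\<And>k. k \<in> jet_indices n \<Longrightarrow> ((\<lambda>s. F t x (U(k := s))) has_real_derivative b k) (at (U k))"
    and D: "D = a + (\<Sum>(i, j)\<in>jet_indices n. U (i, Suc j) * b (i, j))"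
    unfolding has_total_Dx_def by blast
  have "jet_partial k F t x U = b k" if "k \<in> jet_indices n" for k
    unfolding jet_partial_def by (rule DERIV_imp_deriv[OF b[OF that]])
  then show ?thesis
    unfolding D total_Dx_def DERIV_imp_deriv[OF a] by (auto intro!: sum.cong)
qed

lemma has_total_Dx_point:
  assumes f: "smooth f"
  shows "has_total_Dx n (\<lambda>t x U. f (t, x, U (0, 0)))
    (pd_x f (t, x, U (0, 0)) + U (0, 1) * pd_u f (t, x, U (0, 0))) t x U"
proof -
  let ?b = "\<lambda>k. if k = (0, 0) then pd_u f (t, x, U (0, 0)) else 0"
  have "((\<lambda>s. f (t, x, (U(k := s)) (0, 0))) has_real_derivative ?b k) (at (U k))" for k
    using has_pd_u[OF f, of t x "U (0, 0)"] by auto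
  moreover have "(\<Sum>(i, j)\<in>jet_indices n. U (i, Suc j) * ?b (i, j)) =
    (\<Sum>k\<in>jet_indices n. if k = (0, 0) then U (0, 1) * pd_u f (t, x, U (0, 0)) else 0)"
    by (rule sum.cong) (auto split: if_splits)
  then have "(\<Sum>(i, j)\<in>jet_indices n. U (i, Suc j) * ?b (i, j)) = U (0, 1) * pd_u f (t, x, U (0, 0))"
    by (simp add: jet_indices_def[of n, THEN eqset_imp_iff])
  ultimately show ?thesis
    unfolding has_total_Dx_def using has_pd_x[OF f, of t "U (0, 0)" x]
    by (intro exI[of _ "pd_x f (t, x, U (0, 0))"] exI[of _ ?b]) simp
qed

lemma has_total_Dx_coordinate:
  assumes "(i, j) \<in> jet_indices n"
  shows "has_total_Dx n (\<lambda>t x U. U (i, j)) (U (i, Suc j)) t x U"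
proof -
  let ?b = "\<lambda>k. if k = (i, j) then 1 else 0 :: real"
  have "((\<lambda>s. (U(k := s)) (i, j)) has_real_derivative ?b k) (at (U k))" for k
    by auto
  moreover have "(\<Sum>(a, b)\<in>jet_indices n. U (a, Suc b) * ?b (a, b)) =
    (\<Sum>k\<in>jet_indices n. if k = (i, j) then U (i, Suc j) else 0)"
    by (rule sum.cong) (auto split: if_splits)
  then have "(\<Sum>(a, b)\<in>jet_indices n. U (a, Suc b) * ?b (a, b)) = U (i, Suc j)"
    using assms by simp
  ultimately show ?thesis
    unfolding has_total_Dx_def by (intro exI[of _ 0] exI[of _ ?b]) simp
qed

lemma has_total_Dx_add:
  assumes "has_total_Dx n F D t x U" "has_total_Dx n G E t x U"
  shows "has_total_Dx n (\<lambda>t x U. F t x U + G t x U) (D + E) t x U"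
proof -
  from assms obtain a b c d where
    a: "((\<lambda>s. F t s U) has_real_derivative a) (at x)" and c: "((\<lambda>s. G t s U) has_real_derivative c) (at x)"
    and b: "\<And>k. k \<in> jet_indices n \<Longrightarrow> ((\<lambda>s. F t x (U(k := s))) has_real_derivative b k) (at (U k))"
    and d: "\<And>k. k \<in> jet_indices n \<Longrightarrow> ((\<lambda>s. G t x (U(k := s))) has_real_derivative d k) (at (U k))"
    and D: "D = a + (\<Sum>(i, j)\<in>jet_indices n. U (i, Suc j) * b (i, j))"
    and E: "E = c + (\<Sum>(i, j)\<in>jet_indices n. U (i, Suc j) * d (i, j))"
    unfolding has_total_Dx_def by blast
  have "D + E = (a + c) + (\<Sum>(i, j)\<in>jet_indices n. U (i, Suc j) * (b (i, j) + d (i, j)))"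
    unfolding D E by (simp add: case_prod_unfold distrib_left sum.distrib)
  then show ?thesis
    unfolding has_total_Dx_def using DERIV_add[OF a c] DERIV_add[OF b d]
    by (intro exI[of _ "a + c"] exI[of _ "\<lambda>k. b k + d k"] conjI ballI)
qed

lemma has_total_Dx_mult:
  assumes "has_total_Dx n F D t x U" "has_total_Dx n G E t x U"
  shows "has_total_Dx n (\<lambda>t x U. F t x U * G t x U) (D * G t x U + F t x U * E) t x U"
proof -
  from assms obtain a b c d where
    a: "((\<lambda>s. F t s U) has_real_derivative a) (at x)" and c: "((\<lambda>s. G t s U) has_real_derivative c) (at x)"
    and b: "\<And>k. k \<in> jet_indices n \<Longrightarrow> ((\<lambda>s. F t x (U(k := s))) has_real_derivative b k) (at (U k))"
    and d: "\<And>k. k \<in> jet_indices n \<Longrightarrow> ((\<lambda>s. G t x (U(k := s))) has_real_derivative d k) (at (U k))"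
    and D: "D = a + (\<Sum>(i, j)\<in>jet_indices n. U (i, Suc j) * b (i, j))"
    and E: "E = c + (\<Sum>(i, j)\<in>jet_indices n. U (i, Suc j) * d (i, j))"
    unfolding has_total_Dx_def by blast
  have "(\<Sum>(i, j)\<in>jet_indices n. U (i, Suc j) * (b (i, j) * G t x U + d (i, j) * F t x U)) =
      (\<Sum>(i, j)\<in>jet_indices n. U (i, Suc j) * b (i, j)) * G t x U
      + F t x U * (\<Sum>(i, j)\<in>jet_indices n. U (i, Suc j) * d (i, j))"
    unfolding sum_distrib_left sum_distrib_right sum.distrib[symmetric]
    by (intro sum.cong) (auto simp: algebra_simps)
  then have "D * G t x U + F t x U * E = (a * G t x U + c * F t x U)
      + (\<Sum>(i, j)\<in>jet_indices n. U (i, Suc j) * (b (i, j) * G t x U + d (i, j) * F t x U))"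
    unfolding D E by (simp only: distrib_left distrib_right) simp
  moreover have "((\<lambda>s. F t x (U(k := s)) * G t x (U(k := s))) has_real_derivative
      b k * G t x U + d k * F t x U) (at (U k))" if "k \<in> jet_indices n" for k
    using DERIV_mult[OF b[OF that] d[OF that]] by simp
  ultimately show ?thesis
    unfolding has_total_Dx_def using DERIV_mult[OF a c]
    by (intro exI[of _ "a * G t x U + c * F t x U"]
        exI[of _ "\<lambda>k. b k * G t x U + d k * F t x U"] conjI ballI)
qed

lemma has_total_Dx_const: "has_total_Dx n (\<lambda>t x U. c) 0 t x U"
  unfolding has_total_Dx_def by (intro exI[of _ 0] exI[of _ "\<lambda>_. 0"]) simp

lemma has_total_Dx_diff:
  assumes "has_total_Dx n F D t x U" "has_total_Dx n G E t x U"
  shows "has_total_Dx n (\<lambda>t x U. F t x U - G t x U) (D - E) t x U"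
  using has_total_Dx_add[OF assms(1) has_total_Dx_mult[OF has_total_Dx_const[of n "-1"] assms(2)]]
  by simp

text \<open>
  The separate equation lets the rules choose the form of \<open>D\<close>, and the eta-expanded \<open>F\<close> is the
  form in which the rules match.
\<close>

lemma total_Dx_eqI:
  assumes "has_total_Dx n (\<lambda>t x U. F t x U) D t x U" "D = D'"
  shows "total_Dx n (\<lambda>t x U. F t x U) t x U = D'"
  using assms has_total_Dx_imp_eq by blast

section \<open>Invariance of the equation\<close>

text \<open>
  The linearization of the equation applied to the prolongation coefficients.
\<close>

lemma prolongation_Delta:
  "prolongation 3 X Delta t x U =
     prolong_coeff X 1 0 t x U - prolong_coeff X 1 2 t x U
     - prolong_coeff X 0 0 t x U * (4 * U (0, 1) + 2 * U (0, 2) - 2 * U (0, 3))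
     - prolong_coeff X 0 1 t x U * (4 * U (0, 0) + 4 * U (0, 1) - 6 * U (0, 2))
     - prolong_coeff X 0 2 t x U * (2 * U (0, 0) - 6 * U (0, 1))
     + prolong_coeff X 0 3 t x U * (2 * U (0, 0))"
proof -
  have "jet_partial (0, 0) Delta t x U = - (4 * U (0, 1) + 2 * U (0, 2) - 2 * U (0, 3))"
    "jet_partial (1, 0) Delta t x U = 1"
    "jet_partial (0, 1) Delta t x U = - (4 * U (0, 0) + 4 * U (0, 1) - 6 * U (0, 2))"
    "jet_partial (2, 0) Delta t x U = 0"
    "jet_partial (1, 1) Delta t x U = 0"
    "jet_partial (0, 2) Delta t x U = - (2 * U (0, 0) - 6 * U (0, 1))"
    "jet_partial (3, 0) Delta t x U = 0"
    "jet_partial (2, 1) Delta t x U = 0"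
    "jet_partial (1, 2) Delta t x U = - 1"
    "jet_partial (0, 3) Delta t x U = 2 * U (0, 0)"
    unfolding jet_partial_def Delta_def Let_def
    by (rule DERIV_imp_deriv, auto intro!: derivative_eq_intros)+
  note partials = this
  have "deriv (\<lambda>s. Delta s x U) t = 0" "deriv (\<lambda>s. Delta t s U) x = 0"
    by (simp_all add: Delta_def)
  then have "prolongation 3 X Delta t x U =
      (\<Sum>(i, j)\<in>jet_indices 3. prolong_coeff X i j t x U * jet_partial (i, j) Delta t x U)"
    by (simp add: prolongation_def)
  also have "\<dots> = prolong_coeff X 0 0 t x U * jet_partial (0, 0) Delta t x U
      + prolong_coeff X 1 0 t x U + prolong_coeff X 0 1 t x U * jet_partial (0, 1) Delta t x U
      + prolong_coeff X 0 2 t x U * jet_partial (0, 2) Delta t x U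
      - prolong_coeff X 1 2 t x U + prolong_coeff X 0 3 t x U * jet_partial (0, 3) Delta t x U"
    unfolding jet_indices_explicit
    by (simp add: partials(2,4,5,7,8,9) del: One_nat_def)
  finally show ?thesis
    unfolding partials by linarith
qed

section \<open>The determining equations of highest order\<close>

locale symmetry =
  fixes X :: vfield
  assumes generator: "lie_point_symmetry_generator 3 Delta X"
begin

definition "\<tau> p = fst (X p)"
definition "\<xi> p = fst (snd (X p))"
definition "\<eta> p = snd (snd (X p))"

lemma X_eq: "X p = (\<tau> p, \<xi> p, \<eta> p)"
  by (simp add: \<tau>_def \<xi>_def \<eta>_def)

lemma smooth_coefficients: "smooth \<tau>" "smooth \<xi>" "smooth \<eta>"
proof -
  have X: "smooth X" using generator by (simp add: lie_point_symmetry_generator_def)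
  note s = smooth_bounded_linear[OF bounded_linear_snd X]
  show "smooth \<tau>" "smooth \<xi>" "smooth \<eta>"
    unfolding \<tau>_def \<xi>_def \<eta>_def
    using smooth_bounded_linear[OF bounded_linear_fst X]
      smooth_bounded_linear[OF bounded_linear_fst s]
      smooth_bounded_linear[OF bounded_linear_snd s] by simp_all
qed

lemma coeff_eqs:
  "coeff_t X = (\<lambda>t x U. \<tau> (t, x, U (0, 0)))"
  "coeff_x X = (\<lambda>t x U. \<xi> (t, x, U (0, 0)))"
  "coeff_u X = (\<lambda>t x U. \<eta> (t, x, U (0, 0)))"
  by (auto simp: fun_eq_iff coeff_t_def coeff_x_def coeff_u_def \<tau>_def \<xi>_def \<eta>_def)

lemmas total_coeff = smooth_coefficients[THEN total_point_function(1)]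
  smooth_coefficients[THEN total_point_function(2)]

lemma first_prolong:
  "prolong_coeff X 0 0 t x U = \<eta> (t, x, U (0, 0))"
  "prolong_coeff X (Suc 0) 0 t x U =
     pd_t \<eta> (t, x, U (0, 0)) + U (1, 0) * pd_u \<eta> (t, x, U (0, 0))
     - U (1, 0) * (pd_t \<tau> (t, x, U (0, 0)) + U (1, 0) * pd_u \<tau> (t, x, U (0, 0)))
     - U (0, 1) * (pd_t \<xi> (t, x, U (0, 0)) + U (1, 0) * pd_u \<xi> (t, x, U (0, 0)))"
  "prolong_coeff X 0 (Suc 0) t x U =
     pd_x \<eta> (t, x, U (0, 0)) + U (0, 1) * pd_u \<eta> (t, x, U (0, 0))
     - U (1, 0) * (pd_x \<tau> (t, x, U (0, 0)) + U (0, 1) * pd_u \<tau> (t, x, U (0, 0)))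
     - U (0, 1) * (pd_x \<xi> (t, x, U (0, 0)) + U (0, 1) * pd_u \<xi> (t, x, U (0, 0)))"
  by (simp_all add: prolong_coeff.simps coeff_eqs total_coeff)

text \<open>
  Subtracting the invariance conditions at two jets of the equation that agree up to second
  order leaves only the two prolongation coefficients of third order and the term that \<open>u_xxx\<close>
  itself contributes.
\<close>

lemma invariance_top:
  assumes UV: "\<forall>k\<in>jet_indices 2. U k = V k"
    and U: "Delta t x U = 0" and V: "Delta t x V = 0"
  shows "prolong_coeff X 1 2 t x U - prolong_coeff X 1 2 t x V =
     2 * \<eta> (t, x, U (0, 0)) * (U (0, 3) - V (0, 3))
     + 2 * U (0, 0) * (prolong_coeff X 0 3 t x U - prolong_coeff X 0 3 t x V)"
proof -
  have low: "prolong_coeff X i j t x U = prolong_coeff X i j t x V" if "i + j \<le> 2" for i j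
    using jet_order_le_mono[OF jet_order_le_prolong_coeff that] bspec[OF UV] by (rule jet_order_leD)
  have "prolongation 3 X Delta t x U = 0" "prolongation 3 X Delta t x V = 0"
    using generator U V by (simp_all add: lie_point_symmetry_generator_def)
  then show ?thesis
    using low[of 0 0] low[of 1 0] low[of 0 1] low[of 0 2] agree_on_jet_indices_2[OF UV]
    unfolding prolongation_Delta by (simp add: first_prolong(1) numeral_2_eq_2 algebra_simps)
qed

lemma jet_partial_first_prolong:
  "jet_partial (1, 0) (prolong_coeff X 1 0) t x U =
     pd_u \<eta> (t, x, U (0, 0)) - pd_t \<tau> (t, x, U (0, 0)) - 2 * U (1, 0) * pd_u \<tau> (t, x, U (0, 0))
     - U (0, 1) * pd_u \<xi> (t, x, U (0, 0))"
  "jet_partial (0, 1) (prolong_coeff X 1 0) t x U =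
     - (pd_t \<xi> (t, x, U (0, 0)) + U (1, 0) * pd_u \<xi> (t, x, U (0, 0)))"
  "jet_partial (1, 0) (prolong_coeff X 0 1) t x U =
     - (pd_x \<tau> (t, x, U (0, 0)) + U (0, 1) * pd_u \<tau> (t, x, U (0, 0)))"
  "jet_partial (0, 1) (prolong_coeff X 0 1) t x U =
     pd_u \<eta> (t, x, U (0, 0)) - U (1, 0) * pd_u \<tau> (t, x, U (0, 0))
     - pd_x \<xi> (t, x, U (0, 0)) - 2 * U (0, 1) * pd_u \<xi> (t, x, U (0, 0))"
  unfolding jet_partial_def One_nat_def
  by (rule DERIV_imp_deriv, simp add: first_prolong, (rule derivative_eq_intros refl)+, simp add: algebra_simps)+

text \<open>
  The coordinate \<open>u_ttx\<close> does not occur in the equation, hence it can be changed freely. Its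
  only effect is through the prolongation coefficient along \<open>u_txx\<close>, where it is multiplied by \<open>- 2\<close> times the total
  x-derivative of \<open>\<tau>\<close>. That this is zero for every value \<open>q\<close> of \<open>u_x\<close> gives both equations.
\<close>

lemma tau_x_u: "pd_x \<tau> p = 0" "pd_u \<tau> p = 0"
proof -
  obtain t x u where p: "p = (t, x, u)" by (cases p)
  have "pd_x \<tau> (t, x, u) + q * pd_u \<tau> (t, x, u) = 0" for q
  proof -
    let ?V = "(\<lambda>_. 0)((0, 0) := u, (0, 1) := q, (1, 2) := - 4 * u * q - 2 * q\<^sup>2)"
    let ?U = "?V((2, 1) := 1)"
    have UV: "\<forall>k\<in>jet_indices 2. ?U k = ?V k"
      by (auto simp: jet_indices_def)
    have V: "Delta t x ?V = 0" and U: "Delta t x ?U = 0"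
      by (simp_all add: Delta_def Let_def)
    have "total_Dx 0 (coeff_t X) t x ?U = 0"
      using invariance_top[OF UV U V]
      unfolding prolong_12_diff[OF UV] prolong_03_diff[OF UV] by simp
    then show ?thesis by (simp add: coeff_eqs total_coeff)
  qed
  from this[of 0] this[of 1] show "pd_x \<tau> p = 0" "pd_u \<tau> p = 0" by (simp_all add: p)
qed

text \<open>
  Here \<open>r\<close> and \<open>q\<close> are the values of \<open>u_t\<close> and \<open>u_x\<close>. Since both are free, the equation splits
  into \<open>\<xi>_u = 0\<close> and a formula for \<open>\<eta>\<close>.
\<close>

lemma determining_uxxx:
  "2 * u * pd_t \<tau> (t, x, u) + pd_t \<xi> (t, x, u) + 2 * \<eta> (t, x, u) - 2 * u * pd_x \<xi> (t, x, u)
     + (r - 2 * u * q) * pd_u \<xi> (t, x, u) = 0"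
proof -
  let ?V = "(\<lambda>_. 0)((0, 0) := u, (1, 0) := r, (0, 1) := q, (1, 2) := r - 4 * u * q - 2 * q\<^sup>2)"
  \<comment> \<open>Raising \<open>u_xxx\<close> by 1 keeps the equation only if \<open>u_txx\<close> is raised by \<open>2 u\<close>.\<close>
  let ?U = "?V((1, 2) := r - 4 * u * q - 2 * q\<^sup>2 + 2 * u, (0, 3) := 1)"
  have UV: "\<forall>k\<in>jet_indices 2. ?U k = ?V k"
    by (auto simp: jet_indices_def)
  have V: "Delta t x ?V = 0" and U: "Delta t x ?U = 0"
    by (simp_all add: Delta_def Let_def)
  show ?thesis
    using invariance_top[OF UV U V]
    unfolding prolong_12_diff[OF UV] prolong_03_diff[OF UV] jet_partial_first_prolong
    by (simp add: coeff_eqs total_coeff tau_x_u algebra_simps)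
qed

lemma xi_u: "pd_u \<xi> p = 0"
proof -
  obtain t x u where "p = (t, x, u)" by (cases p)
  then show ?thesis using determining_uxxx[of u t x 0 0] determining_uxxx[of u t x 1 0] by simp
qed

lemma eta_eq: "\<eta> (t, x, u) = u * (pd_x \<xi> (t, x, u) - pd_t \<tau> (t, x, u)) - pd_t \<xi> (t, x, u) / 2"
  using determining_uxxx[of u t x 0 0] by (simp add: xi_u algebra_simps)

section \<open>The prolongation in explicit form\<close>

text \<open>
  Derivatives of \<open>\<tau>\<close> with respect to x and u, and of \<open>\<xi>\<close> with respect to u, that vanish together
  with those of \<open>\<tau>\<close> and \<open>\<xi>\<close> themselves; the number at the end of the name counts how many
  derivatives have been taken before.
\<close>

lemmas coefficient_derivatives_0_1 =
  tau_x_u[THEN dir_deriv_swap_eq_0[OF smooth_coefficients(1)]]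
  xi_u[THEN dir_deriv_swap_eq_0[OF smooth_coefficients(2)]]

lemmas coefficient_derivatives_0_2 =
  coefficient_derivatives_0_1(1,2)[THEN dir_deriv_swap_eq_0[OF smooth_dir_deriv[OF smooth_coefficients(1)]]]
  coefficient_derivatives_0_1(3)[THEN dir_deriv_swap_eq_0[OF smooth_dir_deriv[OF smooth_coefficients(2)]]]

lemmas coefficient_derivatives_0 =
  tau_x_u xi_u coefficient_derivatives_0_1 coefficient_derivatives_0_2
  coefficient_derivatives_0_2(3)
    [THEN dir_deriv_swap_eq_0[OF smooth_dir_deriv[OF smooth_dir_deriv[OF smooth_coefficients(2)]]]]

lemma derivatives_eta:
  "pd_u \<eta> (t, x, u) = pd_x \<xi> (t, x, u) - pd_t \<tau> (t, x, u)"
  "pd_x \<eta> (t, x, u) = u * pd_x (pd_x \<xi>) (t, x, u) - pd_x (pd_t \<xi>) (t, x, u) / 2"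
  "pd_t \<eta> (t, x, u) = u * (pd_t (pd_x \<xi>) (t, x, u) - pd_t (pd_t \<tau>) (t, x, u)) - pd_t (pd_t \<xi>) (t, x, u) / 2"
proof -
  note \<xi>x = smooth_dir_deriv[OF smooth_coefficients(2), of "(0, 1, 0)"]
  note \<xi>t = smooth_dir_deriv[OF smooth_coefficients(2), of "(1, 0, 0)"]
  note \<tau>t = smooth_dir_deriv[OF smooth_coefficients(1), of "(1, 0, 0)"]
  have *: "((\<lambda>s. f s * (g s - h s) - k s / 2) has_real_derivative f' * (g s - h s) + f s * (g' - h') - k' / 2) (at s)"
    if "(f has_real_derivative f') (at s)" "(g has_real_derivative g') (at s)"
      "(h has_real_derivative h') (at s)" "(k has_real_derivative k') (at s)" for f g h k f' g' h' k' s
    using that by (auto intro!: derivative_eq_intros)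
  show "pd_u \<eta> (t, x, u) = pd_x \<xi> (t, x, u) - pd_t \<tau> (t, x, u)"
    using DERIV_unique[OF has_pd_u[OF smooth_coefficients(3), of t x u, unfolded eta_eq]
        *[OF DERIV_ident has_pd_u[OF \<xi>x] has_pd_u[OF \<tau>t] has_pd_u[OF \<xi>t]]] by (simp add: coefficient_derivatives_0)
  show "pd_x \<eta> (t, x, u) = u * pd_x (pd_x \<xi>) (t, x, u) - pd_x (pd_t \<xi>) (t, x, u) / 2"
    using DERIV_unique[OF has_pd_x[OF smooth_coefficients(3), of t u x, unfolded eta_eq]
        *[OF DERIV_const has_pd_x[OF \<xi>x] has_pd_x[OF \<tau>t] has_pd_x[OF \<xi>t]]] by (simp add: coefficient_derivatives_0)
  show "pd_t \<eta> (t, x, u) = u * (pd_t (pd_x \<xi>) (t, x, u) - pd_t (pd_t \<tau>) (t, x, u)) - pd_t (pd_t \<xi>) (t, x, u) / 2"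
    using DERIV_unique[OF has_pd_t[OF smooth_coefficients(3), of x u t, unfolded eta_eq]
        *[OF DERIV_const has_pd_t[OF \<xi>x] has_pd_t[OF \<tau>t] has_pd_t[OF \<xi>t]]] by (simp add: coefficient_derivatives_0)
qed

lemmas coefficient_points =
  smooth_dir_deriv[OF smooth_coefficients(1), THEN has_total_Dx_point]
  smooth_dir_deriv[OF smooth_coefficients(2), THEN has_total_Dx_point]
  smooth_dir_deriv[OF smooth_dir_deriv[OF smooth_coefficients(1)], THEN has_total_Dx_point]
  smooth_dir_deriv[OF smooth_dir_deriv[OF smooth_coefficients(2)], THEN has_total_Dx_point]
  smooth_dir_deriv[OF smooth_dir_deriv[OF smooth_dir_deriv[OF smooth_coefficients(2)]], THEN has_total_Dx_point]

lemmas coefficient_intros = has_total_Dx_const coefficient_points has_total_Dx_coordinate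
  has_total_Dx_add has_total_Dx_diff has_total_Dx_mult

lemma total_coeff_x:
  "total_Dx 0 (coeff_t X) t x U = 0"
  "total_Dx 0 (coeff_x X) t x U = pd_x \<xi> (t, x, U (0, 0))"
  by (simp_all add: coeff_eqs total_coeff coefficient_derivatives_0)

text \<open>
  From here on each coefficient is the total x-derivative of an explicit expression that is
  affine in the jet coordinates. Mixed derivatives of \<open>\<xi>\<close> keep the order in which they arise,
  so that \<open>pd_t (pd_x \<xi>)\<close> and \<open>pd_x (pd_t \<xi>)\<close> appear side by side.
\<close>

lemma prolong_01:
  "prolong_coeff X 0 (Suc 0) = (\<lambda>t x U.
     U (0, 0) * pd_x (pd_x \<xi>) (t, x, U (0, 0)) - (1/2) * pd_x (pd_t \<xi>) (t, x, U (0, 0))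
     - U (0, Suc 0) * pd_t \<tau> (t, x, U (0, 0)))"
  by (simp add: fun_eq_iff first_prolong derivatives_eta coefficient_derivatives_0 algebra_simps)

lemma prolong_02:
  "prolong_coeff X 0 (Suc (Suc 0)) = (\<lambda>t x U.
     U (0, 0) * pd_x (pd_x (pd_x \<xi>)) (t, x, U (0, 0)) - (1/2) * pd_x (pd_x (pd_t \<xi>)) (t, x, U (0, 0))
     + U (0, Suc 0) * pd_x (pd_x \<xi>) (t, x, U (0, 0))
     - U (0, Suc (Suc 0)) * (pd_t \<tau> (t, x, U (0, 0)) + pd_x \<xi> (t, x, U (0, 0))))"
  unfolding prolong_coeff.simps(3)[of X 0 "Suc 0"] prolong_01 total_coeff_x fun_eq_iff
  by (intro allI, subst total_Dx_eqI, (rule coefficient_intros | (simp add: jet_indices_def; fail))+,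
     simp_all add: jet_indices_def coefficient_derivatives_0 algebra_simps)

lemma prolong_03:
  "prolong_coeff X 0 (Suc (Suc (Suc 0))) t x U =
     U (0, 0) * pd_x (pd_x (pd_x (pd_x \<xi>))) (t, x, U (0, 0))
     - (1/2) * pd_x (pd_x (pd_x (pd_t \<xi>))) (t, x, U (0, 0))
     + 2 * U (0, Suc 0) * pd_x (pd_x (pd_x \<xi>)) (t, x, U (0, 0))
     - U (0, Suc (Suc (Suc 0))) * (pd_t \<tau> (t, x, U (0, 0)) + 2 * pd_x \<xi> (t, x, U (0, 0)))"
  unfolding prolong_coeff.simps(3)[of X 0 "Suc (Suc 0)"] prolong_02 total_coeff_x
  by (subst total_Dx_eqI, (rule coefficient_intros | (simp add: jet_indices_def; fail))+,
     simp_all add: jet_indices_def coefficient_derivatives_0 algebra_simps)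

lemma prolong_10:
  "prolong_coeff X (Suc 0) 0 = (\<lambda>t x U.
     U (0, 0) * (pd_t (pd_x \<xi>) (t, x, U (0, 0)) - pd_t (pd_t \<tau>) (t, x, U (0, 0)))
     - (1/2) * pd_t (pd_t \<xi>) (t, x, U (0, 0))
     + U (Suc 0, 0) * (pd_x \<xi> (t, x, U (0, 0)) - 2 * pd_t \<tau> (t, x, U (0, 0)))
     - U (0, Suc 0) * pd_t \<xi> (t, x, U (0, 0)))"
  by (simp add: fun_eq_iff first_prolong derivatives_eta coefficient_derivatives_0 algebra_simps)

lemma prolong_11:
  "prolong_coeff X (Suc 0) (Suc 0) = (\<lambda>t x U.
     U (0, 0) * pd_x (pd_t (pd_x \<xi>)) (t, x, U (0, 0)) - (1/2) * pd_x (pd_t (pd_t \<xi>)) (t, x, U (0, 0))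
     + U (0, Suc 0) * (pd_t (pd_x \<xi>) (t, x, U (0, 0)) - pd_t (pd_t \<tau>) (t, x, U (0, 0))
         - pd_x (pd_t \<xi>) (t, x, U (0, 0)))
     + U (Suc 0, 0) * pd_x (pd_x \<xi>) (t, x, U (0, 0))
     - 2 * U (Suc 0, Suc 0) * pd_t \<tau> (t, x, U (0, 0))
     - U (0, Suc (Suc 0)) * pd_t \<xi> (t, x, U (0, 0)))"
  unfolding prolong_coeff.simps(3)[of X "Suc 0" 0] prolong_10 total_coeff_x fun_eq_iff
  by (intro allI, subst total_Dx_eqI, (rule coefficient_intros | (simp add: jet_indices_def; fail))+,
     simp_all add: jet_indices_def coefficient_derivatives_0 algebra_simps)

lemma prolong_12:
  "prolong_coeff X (Suc 0) (Suc (Suc 0)) t x U =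
     U (0, 0) * pd_x (pd_x (pd_t (pd_x \<xi>))) (t, x, U (0, 0))
     - (1/2) * pd_x (pd_x (pd_t (pd_t \<xi>))) (t, x, U (0, 0))
     + U (0, Suc 0) * (2 * pd_x (pd_t (pd_x \<xi>)) (t, x, U (0, 0)) - pd_x (pd_x (pd_t \<xi>)) (t, x, U (0, 0)))
     + U (0, Suc (Suc 0)) * (pd_t (pd_x \<xi>) (t, x, U (0, 0)) - pd_t (pd_t \<tau>) (t, x, U (0, 0))
         - 2 * pd_x (pd_t \<xi>) (t, x, U (0, 0)))
     + U (Suc 0, 0) * pd_x (pd_x (pd_x \<xi>)) (t, x, U (0, 0))
     + U (Suc 0, Suc 0) * pd_x (pd_x \<xi>) (t, x, U (0, 0))
     - U (Suc 0, Suc (Suc 0)) * (2 * pd_t \<tau> (t, x, U (0, 0)) + pd_x \<xi> (t, x, U (0, 0)))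
     - U (0, Suc (Suc (Suc 0))) * pd_t \<xi> (t, x, U (0, 0))"
  unfolding prolong_coeff.simps(3)[of X "Suc 0" "Suc 0"] prolong_11 total_coeff_x
  by (subst total_Dx_eqI, (rule coefficient_intros | (simp add: jet_indices_def; fail))+,
     simp_all add: jet_indices_def coefficient_derivatives_0 algebra_simps)

section \<open>The determining equations of lower order\<close>

lemma invariance_low:
  assumes "U (0, 0) = u" "U (Suc 0, 0) = ut" "U (0, Suc 0) = ux" "U (0, Suc (Suc 0)) = uxx"
    and "U (0, Suc (Suc (Suc 0))) = 0"
    and "U (Suc 0, Suc (Suc 0)) = ut - 4 * u * ux - 2 * ux\<^sup>2 - 2 * u * uxx + 6 * ux * uxx"
  shows "prolong_coeff X (Suc 0) 0 t x U - prolong_coeff X (Suc 0) (Suc (Suc 0)) t x U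
     - \<eta> (t, x, u) * (4 * ux + 2 * uxx)
     - prolong_coeff X 0 (Suc 0) t x U * (4 * u + 4 * ux - 6 * uxx)
     - prolong_coeff X 0 (Suc (Suc 0)) t x U * (2 * u - 6 * ux)
     + prolong_coeff X 0 (Suc (Suc (Suc 0))) t x U * (2 * u) = 0"
proof -
  have "Delta t x U = 0"
    using assms by (simp add: Delta_def Let_def numeral_2_eq_2 numeral_3_eq_3)
  then have "prolongation 3 X Delta t x U = 0"
    using generator by (simp add: lie_point_symmetry_generator_def)
  then show ?thesis
    using assms unfolding prolongation_Delta
    by (simp add: numeral_2_eq_2 numeral_3_eq_3 first_prolong(1))
qed

text \<open>
  Jets of the equation with \<open>u_xxx = 0\<close>; the value at \<open>(1, 2)\<close> is the solution of the equation for
  \<open>u_txx\<close>.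
\<close>

abbreviation jet :: "real \<Rightarrow> real \<Rightarrow> real \<Rightarrow> real \<Rightarrow> real \<Rightarrow> nat \<times> nat \<Rightarrow> real" where
  "jet u ut ux utx uxx \<equiv> (\<lambda>_. 0)((0, 0) := u, (Suc 0, 0) := ut, (0, Suc 0) := ux,
     (Suc 0, Suc 0) := utx, (0, Suc (Suc 0)) := uxx,
     (Suc 0, Suc (Suc 0)) := ut - 4 * u * ux - 2 * ux\<^sup>2 - 2 * u * uxx + 6 * ux * uxx)"

text \<open>
  The invariance condition as a polynomial identity in the remaining free coordinates. In the proofs
  below, its instance with only \<open>u\<close> switched on is the constant term, which cancels against that
  of the other instance.
\<close>

lemmas invariance_jet =
  invariance_low[of "jet u ut ux utx uxx" u ut ux uxx t x for u ut ux utx uxx t x, simplified,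
    unfolded prolong_01 prolong_02 prolong_03 prolong_10 prolong_11 prolong_12, simplified]

lemma xi_xx: "pd_x (pd_x \<xi>) = (\<lambda>_. 0)"
proof
  fix p :: "real \<times> real \<times> real"
  obtain t x u where p: "p = (t, x, u)" by (cases p)
  show "pd_x (pd_x \<xi>) p = 0"
    using
      invariance_jet[where t = t and x = x and u = u and ut = 0 and ux = 0 and utx = 0 and uxx = 0]
      invariance_jet[where t = t and x = x and u = u and ut = 0 and ux = 0 and utx = 1 and uxx = 0]
    unfolding p by (simp add: algebra_simps)
qed

text \<open>
  The equation makes \<open>u_txx\<close> follow \<open>u_t\<close>, so the coefficient of \<open>u_t\<close> collects contributions from
  both. They add up to \<open>2 \<xi>_x - \<xi>_xxx\<close>.
\<close>

lemma xi_x: "pd_x \<xi> = (\<lambda>_. 0)"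
proof
  fix p :: "real \<times> real \<times> real"
  obtain t x u where p: "p = (t, x, u)" by (cases p)
  show "pd_x \<xi> p = 0"
    using
      invariance_jet[where t = t and x = x and u = u and ut = 0 and ux = 0 and utx = 0 and uxx = 0]
      invariance_jet[where t = t and x = x and u = u and ut = 1 and ux = 0 and utx = 0 and uxx = 0]
    unfolding p by (simp add: xi_xx dir_deriv_zero algebra_simps)
qed

lemma xi_tx: "pd_x (pd_t \<xi>) = (\<lambda>_. 0)"
  by (rule ext, rule dir_deriv_swap_eq_0[OF smooth_coefficients(2)]) (simp add: xi_x)

lemma eta_eq': "\<eta> (t, x, u) = - u * pd_t \<tau> (t, x, u) - pd_t \<xi> (t, x, u) / 2"
  by (simp add: eta_eq xi_x)

lemma xi_ttx: "pd_x (pd_t (pd_t \<xi>)) = (\<lambda>_. 0)"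
  by (rule ext, rule dir_deriv_swap_eq_0[OF smooth_dir_deriv[OF smooth_coefficients(2)]]) (simp add: xi_tx)

text \<open>
  The coefficient of \<open>u_x\<close> gives the first equation. The coefficient of \<open>u_xx\<close> is \<open>\<xi>_t + \<tau>_tt\<close>, which
  gives the second.
\<close>

lemma xi_t_tau_tt: "pd_t \<xi> p = 0" "pd_t (pd_t \<tau>) p = 0"
proof -
  obtain t x u where p: "p = (t, x, u)" by (cases p)
  note eqs =
      invariance_jet[where t = t and x = x and u = u and ut = 0 and ux = 0 and utx = 0 and uxx = 0]
      invariance_jet[where t = t and x = x and u = u and ut = 0 and ux = 1 and utx = 0 and uxx = 0]
      invariance_jet[where t = t and x = x and u = u and ut = 0 and ux = 0 and utx = 0 and uxx = 1]
  note eqs' = eqs[unfolded eta_eq' xi_x xi_tx xi_ttx dir_deriv_zero]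
  show "pd_t \<xi> p = 0"
    using eqs'(1,2) unfolding p by (simp add: algebra_simps)
  then show "pd_t (pd_t \<tau>) p = 0"
    using eqs'(1,3) unfolding p by (simp add: algebra_simps)
qed

lemma generator_shape: "\<exists>c1 c2 c3 :: real. \<forall>p. X p = c1 *\<^sub>R X1 p + c2 *\<^sub>R X2 p + c3 *\<^sub>R X3 p"
proof -
  define c1 c2 c3 where c: "c1 = \<xi> (0, 0, 0)" "c2 = \<tau> (0, 0, 0)" "c3 = pd_t \<tau> (0, 0, 0)"
  have \<xi>: "\<xi> p = c1" for p
    unfolding c by (rule constant_if_partials_0[OF smooth_coefficients(2)]) (simp_all add: xi_t_tau_tt xi_x xi_u)
  have \<tau>': "pd_t \<tau> p = c3" for p
    unfolding c by (rule constant_if_partials_0[OF smooth_dir_deriv[OF smooth_coefficients(1)]])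
      (simp_all add: xi_t_tau_tt coefficient_derivatives_0)
  have \<tau>: "\<tau> (t, x, u) = c2 + t * c3" for t x u
  proof -
    have "((\<lambda>s. \<tau> (s, x, u) - s * c3) has_real_derivative 0) (at s)" for s
      using has_pd_t[OF smooth_coefficients(1), of x u s] by (auto intro!: derivative_eq_intros simp: \<tau>')
    then have "\<tau> (t, x, u) - t * c3 = \<tau> (0, x, u)"
      using DERIV_isconst_all[of "\<lambda>s. \<tau> (s, x, u) - s * c3" t 0] by simp
    moreover have "\<tau> (0, x, u) = \<tau> (0, 0, u)"
      using DERIV_isconst_all[of "\<lambda>s. \<tau> (0, s, u)" x 0] has_pd_x[OF smooth_coefficients(1)] tau_x_u by simp
    moreover have "\<tau> (0, 0, u) = \<tau> (0, 0, 0)"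
      using DERIV_isconst_all[of "\<lambda>s. \<tau> (0, 0, s)" u 0] has_pd_u[OF smooth_coefficients(1)] tau_x_u by simp
    ultimately show ?thesis unfolding c(2) by linarith
  qed
  have "X p = c1 *\<^sub>R X1 p + c2 *\<^sub>R X2 p + c3 *\<^sub>R X3 p" for p
  proof -
    obtain t x u where p: "p = (t, x, u)" by (cases p)
    have "X p = (\<tau> (t, x, u), \<xi> (t, x, u), \<eta> (t, x, u))" by (simp add: X_eq p)
    also have "\<dots> = (c2 + t * c3, c1, - u * c3)"
      by (simp add: \<tau> \<xi> eta_eq' \<tau>' xi_t_tau_tt)
    finally show ?thesis by (simp add: X1_def X2_def X3_def p)
  qed
  then show ?thesis by blast
qed

end

theorem theorem2p1:
  fixes X :: "real \<times> real \<times> real \<Rightarrow> real \<times> real \<times> real"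
  assumes "lie_point_symmetry_generator 3 Delta X"
  shows "\<exists>c1 c2 c3 :: real. \<forall>p. X p = c1 *\<^sub>R X1 p + c2 *\<^sub>R X2 p + c3 *\<^sub>R X3 p"
proof -
  interpret symmetry X by standard (rule assms)
  show ?thesis by (rule generator_shape)
qed

end
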